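(* Let $\mathcal{F}_n=\{E_1|H_1,\ldots,E_n|H_n\}$ be a p-consistent finite family of conditional events. For every nonempty subfamily $\mathcal{S}\subseteq\mathcal{F}_n$ we have: (a) $\mathcal{S}$ p-entails $\mathcal{C}(\mathcal{S})$; (b) $\mathcal{F}_n$ p-entails $\mathcal{C}(\mathcal{S})$.
   Context: Events are elements of a Boolean algebra with sure event $\Omega$ and impossible event $\emptyset$; $AB$ is conjunction, $A\vee B$ disjunction, $A^c$ negation, $A\subseteq B$ logical implication; an event is identified with its indicator. A conditional event $E|H$ is given by events $E,H$ with $H\neq\emptyset$; it is true if $EH$ is true, false if $E^cH$ is true, void if $H^c$ is true. $A|H=B|K$ means $AH=BK$ and $H=K$. Coherence. An assessment $(p_1,\ldots,p_n)$ of real numbers, with $p_i=P(E_i|H_i)$, on a finite list of conditional events $E_1|H_1,\ldots,E_n|H_n$ is coherent if for every nonempty $J\subseteq\{1,\ldots,n\}$ and all real numbers $s_j$ ($j\in J$), the random gain $\mathcal{G}=\sum_{j\in J}s_jH_j(E_j-p_j)$, restricted to $\bigvee_{j\in J}H_j$ (i.e. considering its finitely many values on the possible outcomes implying $\bigvee_{j\in J}H_j$), satisfies $\min\mathcal{G}\le 0\le\max\mathcal{G}$. p-consistency. A family $\{E_i|H_i: i=1,\ldots,n\}$ is p-consistent if for every $(\alpha_1,\ldots,\alpha_n)\in[0,1)^n$ there is a coherent assessment $(p_1,\ldots,p_n)$ on it with $p_i\ge\alpha_i$ for all $i$. p-entailment. A p-consistent family $\{E_i|H_i: i=1,\ldots,n\}$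 p-entails $B|A$ if there is a nonempty $J\subseteq\{1,\ldots,n\}$ such that for every $\alpha\in[0,1)$ there exist $\alpha_i\in[0,1)$, $i\in J$, such that for all coherent assessments $(z,p_i, i\in J)$ on $\{B|A,\ E_i|H_i,\ i\in J\}$, with $z=P(B|A)$, $p_i=P(E_i|H_i)$: if $p_i\ge\alpha_i$ for every $i\in J$, then $z\ge\alpha$. Quasi conjunction. For a nonempty finite family $\mathcal{S}=\{E_1|H_1,\ldots,E_s|H_s\}$, $\mathcal{C}(\mathcal{S})$ is the conditional event $\bigwedge_{i=1}^s(E_iH_i\vee H_i^c)\,\big|\,\bigvee_{i=1}^sH_i$. *)

theory Defs
  imports Complex_Main
begin

(* Cond E H stands for E|H. Equality of this datatype is finer than equality of conditional
   events (EH = E'H' and H = H'); families below are indexed, and everything defined on them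
   depends on a member only through E \<sqinter> H and H. *)
datatype 'a cond_event = Cond (conseq: 'a) (ante: 'a)

definition is_cond_event :: "'a::boolean_algebra cond_event \<Rightarrow> bool" where
  "is_cond_event X \<longleftrightarrow> ante X \<noteq> bot"

(* The cases true, false, void. *)
definition components :: "'a::boolean_algebra cond_event \<Rightarrow> 'a set" where
  "components X =
     {inf (conseq X) (ante X), inf (- conseq X) (ante X), - ante X}"

(* The possible outcomes: nonzero meets of one component of each member. Throughout,
   Inf_fin and Sup_fin are meaningful for finite nonempty index sets only. *)
definition constituents :: "'i set \<Rightarrow> ('i \<Rightarrow> 'a::boolean_algebra cond_event) \<Rightarrow> 'a set" where
  "constituents J F =
     {c. c \<noteq> bot \<and> (\<exists>f. (\<forall>j\<in>J. f j \<in> components (F j)) \<and> c = Inf_fin (f ` J))}"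

(* The value of the indicator of A at the outcome c. *)
definition ind :: "'a::boolean_algebra \<Rightarrow> 'a \<Rightarrow> real" where
  "ind A c = (if c \<le> A then 1 else 0)"

(* A constituent need not decide conseq (F j) when it implies - ante (F j), but the
   corresponding summand is then 0. *)
definition gain ::
  "'i set \<Rightarrow> ('i \<Rightarrow> 'a::boolean_algebra cond_event) \<Rightarrow> ('i \<Rightarrow> real) \<Rightarrow> ('i \<Rightarrow> real) \<Rightarrow> 'a \<Rightarrow> real" where
  "gain J F p s c =
     (\<Sum>j\<in>J. s j * ind (ante (F j)) c * (ind (conseq (F j)) c - p j))"

definition gain_values ::
  "'i set \<Rightarrow> ('i \<Rightarrow> 'a::boolean_algebra cond_event) \<Rightarrow> ('i \<Rightarrow> real) \<Rightarrow> ('i \<Rightarrow> real) \<Rightarrow> real set" where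
  "gain_values J F p s =
     gain J F p s ` {c \<in> constituents J F. c \<le> Sup_fin ((\<lambda>j. ante (F j)) ` J)}"

definition coherent ::
  "'i set \<Rightarrow> ('i \<Rightarrow> 'a::boolean_algebra cond_event) \<Rightarrow> ('i \<Rightarrow> real) \<Rightarrow> bool" where
  "coherent I F p \<longleftrightarrow>
     (\<forall>J s. J \<subseteq> I \<longrightarrow> J \<noteq> {} \<longrightarrow>
        Min (gain_values J F p s) \<le> 0 \<and> 0 \<le> Max (gain_values J F p s))"

definition p_consistent :: "'i set \<Rightarrow> ('i \<Rightarrow> 'a::boolean_algebra cond_event) \<Rightarrow> bool" where
  "p_consistent I F \<longleftrightarrow>
     (\<forall>\<alpha>. (\<forall>i\<in>I. \<alpha> i \<in> {0..<1}) \<longrightarrow>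
        (\<exists>p. coherent I F p \<and> (\<forall>i\<in>I. p i \<ge> \<alpha> i)))"

(* The family F on J extended by Y is indexed by insert None (Some ` J), with Y at None. *)
definition p_entails ::
  "'i set \<Rightarrow> ('i \<Rightarrow> 'a::boolean_algebra cond_event) \<Rightarrow> 'a cond_event \<Rightarrow> bool" where
  "p_entails I F Y \<longleftrightarrow>
     p_consistent I F \<and> is_cond_event Y \<and>
     (\<exists>J. J \<subseteq> I \<and> J \<noteq> {} \<and>
       (\<forall>\<alpha>\<in>{0..<1::real}. \<exists>a. (\<forall>i\<in>J. a i \<in> {0..<1::real}) \<and>
         (\<forall>z p. coherent (insert None (Some ` J)) (case_option Y F) (case_option z p) \<longrightarrow>
            (\<forall>i\<in>J. p i \<ge> a i) \<longrightarrow> z \<ge> \<alpha>)))"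

definition quasi_conj :: "'i set \<Rightarrow> ('i \<Rightarrow> 'a::boolean_algebra cond_event) \<Rightarrow> 'a cond_event" where
  "quasi_conj S F =
     Cond (Inf_fin ((\<lambda>i. sup (inf (conseq (F i)) (ante (F i))) (- ante (F i))) ` S))
          (Sup_fin ((\<lambda>i. ante (F i)) ` S))"

end

theory Submission
  imports Defs
begin

text \<open>
  The proof rests on the inequality \<open>z \<ge> 1 - (\<Sum>i\<in>S. 1 - p i)\<close> for every coherent
  assessment of probabilities \<open>p i\<close> on a family \<open>S\<close> and \<open>z\<close> on its quasi conjunction
  (\<open>coherent_quasi_conj_lower_bound\<close>). To see it, bet with stake \<open>1\<close> on each member and with
  stake \<open>-1\<close> on the quasi conjunction. The member bets yield the sum of \<open>1 - p i\<close> over the non-void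
  members, less the number of false ones. If no member is false, the quasi conjunction is true and
  costs \<open>1 - z\<close>; if some member is false, the quasi conjunction is false and pays \<open>z\<close>, but at
  least one unit is lost on the members. In both cases the gain is at most
  \<open>(\<Sum>i\<in>S. 1 - p i) - 1 + z\<close>, because \<open>p i \<le> 1\<close> makes it harmless to
  add the void members to the sum. Coherence forbids a gain that is negative in every outcome, so
  this bound is nonnegative.

  Consequently \<open>z \<ge> \<alpha>\<close> as soon as every \<open>1 - p i\<close> is at most
  \<open>(1 - \<alpha>) / card S\<close>. The definition of p-entailment by a family lets the premises be
  taken from a subfamily, so the same thresholds on \<open>S\<close> serve for \<open>S\<close> itself and for
  every p-consistent family containing it.
\<close>

text \<open>
  The components of a conditional event cover the unit element, so a nonzero element is never
  disjoint from all constituents. This is what makes the set of gains nonempty.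
\<close>

lemma component_meeting:
  fixes x :: "'a::boolean_algebra"
  assumes "x \<noteq> bot"
  shows "\<exists>e\<in>components X. inf x e \<noteq> bot"
proof (rule ccontr)
  assume "\<not> ?thesis"
  then have disj: "inf x (inf (conseq X) (ante X)) = bot"
    "inf x (inf (- conseq X) (ante X)) = bot" "inf x (- ante X) = bot"
    by (auto simp: components_def)
  have cover: "sup (inf (conseq X) (ante X)) (sup (inf (- conseq X) (ante X)) (- ante X)) = top"
    by (simp flip: sup_assoc inf_sup_distrib2)
  have "x = inf x (sup (inf (conseq X) (ante X)) (sup (inf (- conseq X) (ante X)) (- ante X)))"
    unfolding cover by simp
  also have "\<dots> = bot"
    using disj by (simp add: inf_sup_distrib1)
  finally show False
    using assms by simp
qed

lemma constituent_meeting: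
  fixes x :: "'a::boolean_algebra"
  assumes "finite J" "J \<noteq> {}" "x \<noteq> bot"
  shows "\<exists>c\<in>constituents J F. inf x c \<noteq> bot"
proof -
  have "\<exists>f. (\<forall>j\<in>J. f j \<in> components (F j)) \<and> inf x (Inf_fin (f ` J)) \<noteq> bot"
    using assms(1,2)
  proof (induction J rule: finite_ne_induct)
    case (singleton j)
    obtain e where "e \<in> components (F j)" "inf x e \<noteq> bot"
      using component_meeting[OF assms(3)] by blast
    then show ?case
      by (intro exI[of _ "\<lambda>_. e"]) simp
  next
    case (insert j J)
    obtain f where f: "\<forall>j\<in>J. f j \<in> components (F j)" "inf x (Inf_fin (f ` J)) \<noteq> bot"
      using insert.IH by blast
    obtain e where e: "e \<in> components (F j)" "inf (inf x (Inf_fin (f ` J))) e \<noteq> bot"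
      using component_meeting[OF f(2)] by blast
    have "f(j := e) ` insert j J = insert e (f ` J)"
      using insert.hyps by auto
    then have "Inf_fin (f(j := e) ` insert j J) = inf e (Inf_fin (f ` J))"
      using insert.hyps by simp
    then have "inf x (Inf_fin (f(j := e) ` insert j J)) \<noteq> bot"
      using e(2) by (simp add: ac_simps)
    moreover have "\<forall>k\<in>insert j J. (f(j := e)) k \<in> components (F k)"
      using f(1) e(1) by auto
    ultimately show ?case
      by blast
  qed
  then obtain f where f: "\<forall>j\<in>J. f j \<in> components (F j)" "inf x (Inf_fin (f ` J)) \<noteq> bot"
    by blast
  then have "Inf_fin (f ` J) \<in> constituents J F"
    unfolding constituents_def by auto
  with f(2) show ?thesis
    by blast
qed

lemma finite_constituents:
  assumes "finite J"
  shows "finite (constituents J F)"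
proof -
  have "constituents J F \<subseteq> Inf_fin ` Pow (\<Union>j\<in>J. components (F j))"
    unfolding constituents_def by blast
  moreover have "finite (\<Union>j\<in>J. components (F j))"
    using assms by (simp add: components_def)
  ultimately show ?thesis
    by (meson finite_Pow_iff finite_imageI finite_subset)
qed

lemma constituent_cases:
  assumes "c \<in> constituents J F" "finite J" "j \<in> J"
  obtains (true) "c \<le> conseq (F j)" "c \<le> ante (F j)"
    | (false) "c \<le> - conseq (F j)" "c \<le> ante (F j)"
    | (void) "c \<le> - ante (F j)"
proof -
  obtain f where f: "\<forall>j\<in>J. f j \<in> components (F j)" "c = Inf_fin (f ` J)"
    using assms(1) unfolding constituents_def by blast
  have "c \<le> f j"
    using assms(2,3) f(2) by (simp add: Inf_fin.coboundedI)
  moreover have "f j \<in> components (F j)"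
    using f(1) assms(3) by blast
  ultimately show thesis
    using that unfolding components_def by auto
qed

lemma nonbot_not_le_compl:
  fixes c :: "'a::boolean_algebra"
  assumes "c \<noteq> bot" "c \<le> - a"
  shows "\<not> c \<le> a"
  using assms by (metis bot.extremum_uniqueI inf.bounded_iff inf_compl_bot)

lemma gain_values_nonempty:
  assumes "finite J" "j \<in> J" "is_cond_event (F j)"
  shows "gain_values J F p s \<noteq> {}"
proof -
  obtain c where c: "c \<in> constituents J F" "inf (ante (F j)) c \<noteq> bot"
    using constituent_meeting[of J "ante (F j)"] assms unfolding is_cond_event_def by blast
  have "c \<le> ante (F j)"
    using c(1) assms(1,2)
  proof (cases rule: constituent_cases)
    case void
    then have "inf (ante (F j)) c = bot"
      by (metis inf.commute inf_shunt)
    with c(2) show ?thesis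
      by simp
  qed
  also have "\<dots> \<le> Sup_fin ((\<lambda>j. ante (F j)) ` J)"
    using assms(1,2) by (simp add: Sup_fin.coboundedI)
  finally show ?thesis
    using c(1) unfolding gain_values_def by blast
qed

text \<open>
  Each use of coherence below has this form: a number that bounds from above the gain in all
  outcomes where some bet is in force cannot be negative.
\<close>

lemma coherent_gain_bound_nonneg:
  assumes coh: "coherent I F p" and J: "J \<subseteq> I" "finite J" "j \<in> J" "is_cond_event (F j)"
    and bound: "\<And>c. c \<in> constituents J F \<Longrightarrow> c \<le> Sup_fin ((\<lambda>j. ante (F j)) ` J) \<Longrightarrow>
      gain J F p s c \<le> b"
  shows "0 \<le> b"
proof -
  have "0 \<le> Max (gain_values J F p s)"
    using coh J(1,3) unfolding coherent_def by blast
  also have "\<dots> \<le> b"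
    using gain_values_nonempty[of J j F p s] J bound finite_constituents[of J F]
    by (subst Max_le_iff) (auto simp: gain_values_def)
  finally show ?thesis .
qed

lemma coherent_le_one:
  assumes "coherent I F p" "i \<in> I" "is_cond_event (F i)"
  shows "p i \<le> 1"
proof -
  have "0 \<le> 1 - p i"
  proof (rule coherent_gain_bound_nonneg[where J = "{i}" and j = i and s = "\<lambda>_. 1"])
    show "gain {i} F p (\<lambda>_. 1) c \<le> 1 - p i"
      if "c \<le> Sup_fin ((\<lambda>j. ante (F j)) ` {i})" for c
      using that by (simp add: gain_def ind_def)
  qed (use assms in auto)
  then show ?thesis
    by simp
qed

lemma coherent_subset: "coherent I F p \<Longrightarrow> K \<subseteq> I \<Longrightarrow> coherent K F p"
  unfolding coherent_def by blast

lemma p_consistent_subset: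
  fixes F :: "'i \<Rightarrow> 'a::boolean_algebra cond_event"
  assumes "p_consistent I F" "K \<subseteq> I"
  shows "p_consistent K F"
  unfolding p_consistent_def
proof (intro allI impI)
  fix \<alpha> :: "'i \<Rightarrow> real"
  assume \<alpha>: "\<forall>i\<in>K. \<alpha> i \<in> {0..<1}"
  define \<beta> where "\<beta> = (\<lambda>i. if i \<in> K then \<alpha> i else 0)"
  have "\<forall>i\<in>I. \<beta> i \<in> {0..<1}"
    using \<alpha> by (auto simp: \<beta>_def)
  with assms(1)[unfolded p_consistent_def, THEN spec, of \<beta>]
  obtain p where p: "coherent I F p" "\<forall>i\<in>I. p i \<ge> \<beta> i"
    by blast
  have "\<forall>i\<in>K. p i \<ge> \<alpha> i"
  proof
    fix i assume "i \<in> K"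
    with p(2) assms(2) have "p i \<ge> \<beta> i"
      by blast
    with \<open>i \<in> K\<close> show "p i \<ge> \<alpha> i"
      by (simp add: \<beta>_def)
  qed
  then show "\<exists>p. coherent K F p \<and> (\<forall>i\<in>K. p i \<ge> \<alpha> i)"
    using coherent_subset[OF p(1) assms(2)] by blast
qed

lemma is_cond_event_quasi_conj:
  assumes "finite S" "i \<in> S" "is_cond_event (F i)"
  shows "is_cond_event (quasi_conj S F)"
proof -
  have "ante (F i) \<le> ante (quasi_conj S F)"
    using assms(1,2) by (simp add: quasi_conj_def Sup_fin.coboundedI)
  then show ?thesis
    using assms(3) unfolding is_cond_event_def by (metis bot.extremum_uniqueI)
qed

text \<open>
  The restriction of the gain to the disjunction of all antecedents guarantees that the bet on the
  quasi conjunction is in force, its antecedent being the disjunction of the others.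
\<close>

lemma coherent_quasi_conj_lower_bound:
  fixes F :: "'i \<Rightarrow> 'a::boolean_algebra cond_event"
  assumes fin: "finite S" and ne: "S \<noteq> {}" and ev: "\<forall>i\<in>S. is_cond_event (F i)"
    and coh: "coherent (insert None (Some ` S)) (case_option (quasi_conj S F) F) (case_option z p)"
  shows "1 - (\<Sum>i\<in>S. 1 - p i) \<le> z"
proof -
  let ?J = "insert None (Some ` S)"
  let ?Q = "quasi_conj S F"
  let ?F = "case_option ?Q F"
  let ?p = "case_option z p"
  let ?s = "case_option (-1) (\<lambda>_. 1) :: 'i option \<Rightarrow> real"
  have p_le: "p i \<le> 1" if "i \<in> S" for i
    using coherent_le_one[OF coh, of "Some i"] that ev by simp
  have "0 \<le> (\<Sum>i\<in>S. 1 - p i) - 1 + z"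
  proof (rule coherent_gain_bound_nonneg[OF coh subset_refl, where j = None and s = ?s])
    show "is_cond_event (?F None)"
      using fin ne ev is_cond_event_quasi_conj[of S _ F] by (simp, meson all_not_in_conv)
    fix c
    assume c: "c \<in> constituents ?J ?F" and c_le: "c \<le> Sup_fin ((\<lambda>j. ante (?F j)) ` ?J)"
    have c_ne: "c \<noteq> bot"
      using c unfolding constituents_def by blast
    have "Sup_fin ((\<lambda>j. ante (?F j)) ` ?J) = ante ?Q"
      using fin ne by (simp add: quasi_conj_def image_image)
    with c_le have indQ: "ind (ante ?Q) c = 1"
      by (simp add: ind_def)
    let ?g = "\<lambda>i. ind (ante (F i)) c * (ind (conseq (F i)) c - p i)"
    have gain_eq: "gain ?J ?F ?p ?s c = sum ?g S - (ind (conseq ?Q) c - z)"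
      using fin indQ by (simp add: gain_def sum.reindex)
    have cases: "(c \<le> conseq (F i) \<and> c \<le> ante (F i)) \<or>
        (c \<le> - conseq (F i) \<and> c \<le> ante (F i)) \<or> c \<le> - ante (F i)" if "i \<in> S" for i
      using constituent_cases[OF c, of "Some i"] that fin by auto
    have g_le: "?g i \<le> 1 - p i" if "i \<in> S" for i
      using cases[OF that] p_le[OF that] nonbot_not_le_compl[OF c_ne]
      by (auto simp: ind_def)
    show "gain ?J ?F ?p ?s c \<le> (\<Sum>i\<in>S. 1 - p i) - 1 + z"
    proof (cases "\<exists>i\<in>S. c \<le> - conseq (F i) \<and> c \<le> ante (F i)")
      case True
      then obtain i where i: "i \<in> S" "c \<le> - conseq (F i)" "c \<le> ante (F i)"
        by blast
      have gi: "?g i = - p i"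
        using i nonbot_not_le_compl[OF c_ne] by (simp add: ind_def)
      have "sum ?g (S - {i}) \<le> (\<Sum>i\<in>S - {i}. 1 - p i)"
        by (rule sum_mono) (use g_le in blast)
      then have "sum ?g S \<le> (\<Sum>i\<in>S. 1 - p i) - 1"
        using gi by (simp add: sum.remove[OF fin i(1)])
      moreover have "ind (conseq ?Q) c \<ge> 0"
        by (simp add: ind_def)
      ultimately show ?thesis
        unfolding gain_eq by linarith
    next
      case False
      have "c \<le> sup (inf (conseq (F i)) (ante (F i))) (- ante (F i))" if "i \<in> S" for i
        using cases[OF that] False that by (auto intro: le_supI1 le_supI2)
      then have "c \<le> conseq ?Q"
        using fin ne by (auto simp: quasi_conj_def intro!: Inf_fin.boundedI)
      then have "ind (conseq ?Q) c = 1"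
        by (simp add: ind_def)
      moreover have "sum ?g S \<le> (\<Sum>i\<in>S. 1 - p i)"
        by (rule sum_mono) (use g_le in blast)
      ultimately show ?thesis
        unfolding gain_eq by linarith
    qed
  qed (use fin in auto)
  then show ?thesis
    by simp
qed

lemma p_entails_quasi_conj:
  fixes F :: "'i \<Rightarrow> 'a::boolean_algebra cond_event"
  assumes cons: "p_consistent I F" and S: "S \<subseteq> I" "finite S" "S \<noteq> {}"
    and ev: "\<forall>i\<in>S. is_cond_event (F i)"
  shows "p_entails I F (quasi_conj S F)"
  unfolding p_entails_def
proof (intro conjI exI[of _ S] ballI)
  show "is_cond_event (quasi_conj S F)"
    using S(2,3) ev is_cond_event_quasi_conj[of S _ F] by (meson all_not_in_conv)
  fix \<alpha> :: real
  assume \<alpha>: "\<alpha> \<in> {0..<1}"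
  let ?a = "1 - (1 - \<alpha>) / card S"
  have card: "real (card S) \<ge> 1"
    using S(2,3) by (simp add: Suc_le_eq card_gt_0_iff)
  have "?a \<in> {0..<1}"
    using \<alpha> card by (simp add: divide_le_eq_1)
  moreover have "z \<ge> \<alpha>"
    if coh: "coherent (insert None (Some ` S)) (case_option (quasi_conj S F) F) (case_option z p)"
      and p: "\<forall>i\<in>S. p i \<ge> ?a" for z p
  proof -
    have "(\<Sum>i\<in>S. 1 - p i) \<le> (\<Sum>i\<in>S. (1 - \<alpha>) / card S)"
      by (rule sum_mono) (use p in force)
    also have "\<dots> = 1 - \<alpha>"
      using card by simp
    finally show ?thesis
      using coherent_quasi_conj_lower_bound[OF S(2,3) ev coh] by linarith
  qed
  ultimately show "\<exists>a. (\<forall>i\<in>S. a i \<in> {0..<1::real}) \<and>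
      (\<forall>z p. coherent (insert None (Some ` S)) (case_option (quasi_conj S F) F)
          (case_option z p) \<longrightarrow> (\<forall>i\<in>S. p i \<ge> a i) \<longrightarrow> z \<ge> \<alpha>)"
    by (intro exI[of _ "\<lambda>_. ?a"]) blast
qed (use cons S in auto)

theorem theorem5:
  fixes F :: "nat \<Rightarrow> 'a::boolean_algebra cond_event" and n :: nat and S :: "nat set"
  assumes "\<forall>i\<in>{1..n}. is_cond_event (F i)"
    and "p_consistent {1..n} F"
    and "S \<subseteq> {1..n}" and "S \<noteq> {}"
  shows "p_entails S F (quasi_conj S F) \<and> p_entails {1..n} F (quasi_conj S F)"
proof -
  have "finite S" "\<forall>i\<in>S. is_cond_event (F i)"
    using assms(1,3) finite_subset by auto
  then show ?thesis
    using p_entails_quasi_conj[OF p_consistent_subset[OF assms(2,3)] subset_refl]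
      p_entails_quasi_conj[OF assms(2,3)] assms(4)
    by blast
qed

end
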